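(* Let $n\ge1$ and let $\Bbbk$ be a field. The Loewy length of $\Bbbk\,\mathcal{EF}_n$, and hence of $\Bbbk\,\mathcal{PF}_n$, is $\binom n2+1$.
   Context: $[n]=\{1,\dots,n\}$. $\mathcal{PF}_n$ is the monoid of all order-decreasing partial functions $f$ on $[n]$ ($f(x)\le x$ for every $x$ in the domain of $f$); $\Bbbk\mathcal{PF}_n$ is its monoid algebra. $\mathcal{EF}_n$ is the category whose objects are all subsets of $[n]$ and whose morphisms $A\to B$ are the order-decreasing onto functions with domain $A$ and range $B$. The category algebra $\Bbbk\mathcal{EF}_n$ has basis the morphisms, with product $m'\cdot m=m'm$ if the composition is defined and $0$ otherwise. It is known that $\Bbbk\mathcal{PF}_n\simeq\Bbbk\mathcal{EF}_n$ as algebras. The Loewy length of a finite-dimensional algebra $A$ is the minimal integer $m$ with $\mathrm{Rad}^mA=0$. *)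

theory Defs
  imports "HOL-Algebra.Ideal_Product" "HOL-Algebra.Module"
begin

section \<open>Jacobson radical and Loewy length\<close>

locale left_ideal = additive_subgroup I R + ring R for I and R (structure) +
  assumes I_l_closed: "\<lbrakk>a \<in> I; x \<in> carrier R\<rbrakk> \<Longrightarrow> x \<otimes> a \<in> I"

locale maximal_left_ideal = left_ideal +
  assumes I_notcarr: "carrier R \<noteq> I"
    and I_maximal: "\<lbrakk>left_ideal J R; I \<subseteq> J; J \<subseteq> carrier R\<rbrakk> \<Longrightarrow> J = I \<or> J = carrier R"

text \<open>
  In a unital algebra over a field every left ideal of the underlying ring is a linear
  subspace, so the radical of the algebra is the radical of its underlying ring.
\<close>

definition jacobson_radical :: "('a, 'b) ring_scheme \<Rightarrow> 'a set" where
  "jacobson_radical R = carrier R \<inter> \<Inter>{I. maximal_left_ideal I R}"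

text \<open>
  Powers of the radical are taken in the multiplicative monoid of two-sided ideals; in
  particular the power with exponent \<open>0\<close> is the whole ring.
\<close>

definition loewy_length :: "('a, 'b) ring_scheme \<Rightarrow> nat" where
  "loewy_length R =
     (LEAST m. jacobson_radical R [^]\<^bsub>ideals_set R\<^esub> m = {\<zero>\<^bsub>R\<^esub>})"


section \<open>Monoid algebras and category algebras\<close>

text \<open>
  Formal linear combinations of elements of \<open>X\<close> are represented by their coefficient
  functions.
\<close>

definition lin_combs :: "'x set \<Rightarrow> ('x \<Rightarrow> 'k::field) set" where
  "lin_combs X = {a. finite {x. a x \<noteq> 0} \<and> {x. a x \<noteq> 0} \<subseteq> X}"

definition monoid_algebra ::
  "'k::field itself \<Rightarrow> ('x, 'c) monoid_scheme \<Rightarrow> ('k, 'x \<Rightarrow> 'k) module" where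
  "monoid_algebra _ M =
    \<lparr> carrier = lin_combs (carrier M),
      mult = (\<lambda>a b x. \<Sum>(y, z) \<in> {(y, z). a y \<noteq> 0 \<and> b z \<noteq> 0 \<and> y \<otimes>\<^bsub>M\<^esub> z = x}. a y * b z),
      one = (\<lambda>x. if x = \<one>\<^bsub>M\<^esub> then 1 else 0),
      zero = (\<lambda>x. 0),
      add = (\<lambda>a b x. a x + b x),
      smult = (\<lambda>c a x. c * a x) \<rparr>"

text \<open>
  \<open>comp_mor C g f\<close> is the composite ``\<open>g\<close> after \<open>f\<close>''. It is meaningful only for
  \<open>source C g = target C f\<close>.
\<close>

record ('o, 'm) cat =
  objects :: "'o set"
  arrows :: "'m set"
  source :: "'m \<Rightarrow> 'o"
  target :: "'m \<Rightarrow> 'o"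
  ident :: "'o \<Rightarrow> 'm"
  comp_mor :: "'m \<Rightarrow> 'm \<Rightarrow> 'm"

locale category =
  fixes C :: "('o, 'm) cat"
  assumes source_closed: "f \<in> arrows C \<Longrightarrow> source C f \<in> objects C"
    and target_closed: "f \<in> arrows C \<Longrightarrow> target C f \<in> objects C"
    and ident_closed: "A \<in> objects C \<Longrightarrow> ident C A \<in> arrows C"
    and source_ident: "A \<in> objects C \<Longrightarrow> source C (ident C A) = A"
    and target_ident: "A \<in> objects C \<Longrightarrow> target C (ident C A) = A"
    and comp_closed:
      "\<lbrakk>f \<in> arrows C; g \<in> arrows C; source C g = target C f\<rbrakk>
        \<Longrightarrow> comp_mor C g f \<in> arrows C"
    and source_comp:
      "\<lbrakk>f \<in> arrows C; g \<in> arrows C; source C g = target C f\<rbrakk>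
        \<Longrightarrow> source C (comp_mor C g f) = source C f"
    and target_comp:
      "\<lbrakk>f \<in> arrows C; g \<in> arrows C; source C g = target C f\<rbrakk>
        \<Longrightarrow> target C (comp_mor C g f) = target C g"
    and comp_ident: "f \<in> arrows C \<Longrightarrow> comp_mor C f (ident C (source C f)) = f"
    and ident_comp: "f \<in> arrows C \<Longrightarrow> comp_mor C (ident C (target C f)) f = f"
    and comp_assoc:
      "\<lbrakk>f \<in> arrows C; g \<in> arrows C; h \<in> arrows C;
        source C g = target C f; source C h = target C g\<rbrakk>
        \<Longrightarrow> comp_mor C (comp_mor C h g) f = comp_mor C h (comp_mor C g f)"

text \<open>
  The unit of the category algebra is the sum of all identity morphisms; this requires
  the set of objects to be finite.
\<close>

definition category_algebra ::
  "'k::field itself \<Rightarrow> ('o, 'm) cat \<Rightarrow> ('k, 'm \<Rightarrow> 'k) module" where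
  "category_algebra _ C =
    \<lparr> carrier = lin_combs (arrows C),
      mult = (\<lambda>a b f. \<Sum>(g, h) \<in> {(g, h). a g \<noteq> 0 \<and> b h \<noteq> 0 \<and>
                source C g = target C h \<and> comp_mor C g h = f}. a g * b h),
      one = (\<lambda>f. if f \<in> ident C ` objects C then 1 else 0),
      zero = (\<lambda>f. 0),
      add = (\<lambda>a b f. a f + b f),
      smult = (\<lambda>c a f. c * a f) \<rparr>"


section \<open>Order-decreasing partial functions\<close>

definition order_decreasing :: "(nat \<rightharpoonup> nat) \<Rightarrow> bool" where
  "order_decreasing f \<longleftrightarrow> (\<forall>x \<in> dom f. the (f x) \<le> x)"

definition id_on_set :: "'a set \<Rightarrow> ('a \<rightharpoonup> 'a)" where
  "id_on_set A = Some |` A"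

definition PF :: "nat \<Rightarrow> (nat \<rightharpoonup> nat) monoid" where
  "PF n =
    \<lparr> carrier = {f. dom f \<subseteq> {1..n} \<and> ran f \<subseteq> {1..n} \<and> order_decreasing f},
      mult = (\<circ>\<^sub>m),
      one = id_on_set {1..n} \<rparr>"

definition EF_hom :: "nat set \<Rightarrow> nat set \<Rightarrow> (nat \<rightharpoonup> nat) set" where
  "EF_hom A B = {f. dom f = A \<and> ran f = B \<and> order_decreasing f}"

definition EF :: "nat \<Rightarrow> (nat set, nat \<rightharpoonup> nat) cat" where
  "EF n =
    \<lparr> objects = Pow {1..n},
      arrows = (\<Union>A \<in> Pow {1..n}. \<Union>B \<in> Pow {1..n}. EF_hom A B),
      source = dom,
      target = ran,
      ident = id_on_set,
      comp_mor = (\<circ>\<^sub>m) \<rparr>"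

lemma id_on_set_apply: "id_on_set A x = (if x \<in> A then Some x else None)"
  by (simp add: id_on_set_def restrict_map_def)

lemma ran_map_comp_subset: "ran (g \<circ>\<^sub>m f) \<subseteq> ran g"
  by (auto simp: ran_def map_comp_def split: option.splits)

lemma dom_map_comp_subset: "dom (g \<circ>\<^sub>m f) \<subseteq> dom f"
  by (auto simp: map_comp_def split: option.splits)

lemma dom_map_comp_eq: "dom g = ran f \<Longrightarrow> dom (g \<circ>\<^sub>m f) = dom f"
  by (fastforce simp: dom_def ran_def map_comp_def split: option.splits)

lemma ran_map_comp_eq: "dom g = ran f \<Longrightarrow> ran (g \<circ>\<^sub>m f) = ran g"
  by (fastforce simp: dom_def ran_def map_comp_def split: option.splits)

lemma order_decreasing_comp:
  assumes "order_decreasing f" "order_decreasing g"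
  shows "order_decreasing (g \<circ>\<^sub>m f)"
  unfolding order_decreasing_def
proof
  fix x assume "x \<in> dom (g \<circ>\<^sub>m f)"
  then obtain y z where "f x = Some y" "g y = Some z"
    by (auto simp: map_comp_def split: option.splits)
  moreover from this have "y \<le> x" "z \<le> y"
    using assms unfolding order_decreasing_def by (metis domI option.sel)+
  ultimately show "the ((g \<circ>\<^sub>m f) x) \<le> x"
    by simp
qed

lemma order_decreasing_id: "order_decreasing (id_on_set A)"
  by (auto simp: order_decreasing_def id_on_set_apply split: if_splits)

lemma dom_id_on_set [simp]: "dom (id_on_set A) = A"
  by (auto simp: dom_def id_on_set_apply)

lemma ran_id_on_set [simp]: "ran (id_on_set A) = A"
  by (auto simp: ran_def id_on_set_apply)

lemma comp_id_on_set: "dom f \<subseteq> A \<Longrightarrow> f \<circ>\<^sub>m id_on_set A = f"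
  by (rule ext) (metis domIff id_on_set_apply map_comp_simps subsetD)

lemma id_on_set_comp: "ran f \<subseteq> A \<Longrightarrow> id_on_set A \<circ>\<^sub>m f = f"
  by (auto simp: fun_eq_iff map_comp_def id_on_set_apply ran_def split: option.splits)

lemma map_comp_assoc: "(h \<circ>\<^sub>m g) \<circ>\<^sub>m f = h \<circ>\<^sub>m (g \<circ>\<^sub>m f)"
  by (auto simp: fun_eq_iff map_comp_def split: option.splits)

lemma monoid_PF: "monoid (PF n)"
proof (rule monoidI)
  fix f g assume "f \<in> carrier (PF n)" "g \<in> carrier (PF n)"
  then show "f \<otimes>\<^bsub>PF n\<^esub> g \<in> carrier (PF n)"
    using ran_map_comp_subset[of f g] dom_map_comp_subset[of f g]
    by (simp add: PF_def order_decreasing_comp subset_trans)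
qed (auto simp: PF_def order_decreasing_id comp_id_on_set id_on_set_comp map_comp_assoc)

lemma category_EF: "category (EF n)"
  by unfold_locales
    (auto simp: EF_def EF_hom_def order_decreasing_id order_decreasing_comp comp_id_on_set
      id_on_set_comp map_comp_assoc dom_map_comp_eq ran_map_comp_eq)

end

theory Submission
  imports Defs "HOL-Algebra.QuotRing"
begin

text \<open>
  Give a subset \<open>A\<close> of \<open>{1..n}\<close> the rank \<open>\<Sum>x\<in>A. x - 1\<close>. It drops along every non-identity
  morphism of the category, so the span of the non-identity morphisms is a nilpotent ideal;
  as the quotient by it is a product of copies of the field, it is the radical, and its
  \<open>m\<close>-th power is supported on morphisms lowering the rank by at least \<open>m\<close>. The maximal rank
  \<open>n choose 2\<close>, attained by \<open>{1..n}\<close>, therefore bounds the nonzero powers. The bound is sharp: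
  the constant map \<open>{1..n} \<rightarrow> {1}\<close> is a product of morphisms each lowering the rank by one.

  Sending a partial function to the sum of all its restrictions, regarded as morphisms, is an
  isomorphism from the monoid algebra onto the category algebra: it is multiplicative by the unique
  factorization of restrictions of a composite, and bijective by triangularity.
\<close>

section \<open>Invariance of the Loewy length under isomorphism\<close>

lemma left_ideal_image:
  assumes "ring R" "ring S" "h \<in> ring_iso R S" "left_ideal I R"
  shows "left_ideal (h ` I) S"
proof -
  interpret R: ring R by fact
  interpret S: ring S by fact
  interpret h: ring_hom_ring R S h
    using assms by unfold_locales (auto simp: ring_iso_def)
  interpret I: left_ideal I R by fact
  have "subgroup (h ` I) (add_monoid S)"
    using group_hom.subgroup_img_is_subgroup[OF h.a_group_hom] I.a_subgroup by blast
  moreover have "x \<otimes>\<^bsub>S\<^esub> a \<in> h ` I" if a: "a \<in> h ` I" and x: "x \<in> carrier S" for a x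
  proof -
    obtain y where y: "y \<in> carrier R" "x = h y"
      using x ring_iso_memE(5)[OF assms(3)] by (auto simp: bij_betw_def)
    obtain b where b: "b \<in> I" "a = h b"
      using a by blast
    have "x \<otimes>\<^bsub>S\<^esub> a = h (y \<otimes>\<^bsub>R\<^esub> b)"
      using y b I.a_Hcarr by simp
    then show ?thesis
      using I.I_l_closed y b by blast
  qed
  ultimately show ?thesis
    using S.ring_axioms
    by (auto simp: left_ideal_def left_ideal_axioms_def additive_subgroup_def)
qed

lemma maximal_left_ideal_image:
  assumes "ring R" "ring S" and h: "h \<in> ring_iso R S" and I: "maximal_left_ideal I R"
  shows "maximal_left_ideal (h ` I) S"
proof -
  interpret I: maximal_left_ideal I R by fact
  define g where "g = inv_into (carrier R) h"
  have g: "g \<in> ring_iso S R"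
    unfolding g_def using ring_iso_set_sym[OF assms(1) h] .
  have bij: "bij_betw h (carrier R) (carrier S)"
    using ring_iso_memE(5)[OF h] .
  have hg: "h ` g ` J = J" if "J \<subseteq> carrier S" for J
    unfolding g_def image_comp using that bij
    by (simp add: bij_betw_def image_cong[of J J "h \<circ> inv_into (carrier R) h" id] f_inv_into_f subset_iff)
  have gh: "g ` h ` I = I"
    unfolding g_def using bij I.a_subset by (simp add: bij_betw_def inv_into_image_cancel)
  have "left_ideal (h ` I) S"
    using left_ideal_image[OF assms(1,2) h] I.left_ideal_axioms by blast
  then interpret L: left_ideal "h ` I" S .
  show ?thesis
  proof unfold_locales
    show "carrier S \<noteq> h ` I"
      using I.I_notcarr gh hg[of "carrier S"] bij by (metis bij_betw_imp_surj_on g ring_iso_memE(5))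
  next
    fix J assume J: "left_ideal J S" "h ` I \<subseteq> J" "J \<subseteq> carrier S"
    have "left_ideal (g ` J) R"
      using left_ideal_image[OF assms(2,1) g J(1)] .
    moreover have "I \<subseteq> g ` J"
      using J(2) gh by blast
    moreover have "g ` J \<subseteq> carrier R"
      using J(3) ring_iso_memE(1)[OF g] by blast
    ultimately have "g ` J = I \<or> g ` J = carrier R"
      by (rule I.I_maximal)
    then have "h ` g ` J = h ` I \<or> h ` g ` J = h ` carrier R"
      by metis
    then show "J = h ` I \<or> J = carrier S"
      using hg[OF J(3)] bij by (simp add: bij_betw_def)
  qed
qed

lemma jacobson_radical_subset_image:
  assumes "ring R" "ring S" "h \<in> ring_iso R S"
  shows "jacobson_radical S \<subseteq> h ` jacobson_radical R"
proof
  fix y assume y: "y \<in> jacobson_radical S"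
  have bij: "bij_betw h (carrier R) (carrier S)"
    using ring_iso_memE(5)[OF assms(3)] .
  obtain x where x: "x \<in> carrier R" "y = h x"
    using y bij by (auto simp: jacobson_radical_def bij_betw_def)
  have "x \<in> I" if I: "maximal_left_ideal I R" for I
  proof -
    have "y \<in> h ` I"
      using maximal_left_ideal_image[OF assms I] y by (auto simp: jacobson_radical_def)
    moreover have "I \<subseteq> carrier R"
      using I additive_subgroup.a_subset
      by (auto simp: maximal_left_ideal_def left_ideal_def)
    ultimately show ?thesis
      using x bij by (metis bij_betw_def inj_on_image_mem_iff)
  qed
  then show "y \<in> h ` jacobson_radical R"
    using x by (auto simp: jacobson_radical_def)
qed

text \<open>The remaining inclusion is the preceding lemma for the inverse isomorphism, pushed
  forward by \<open>h\<close>.\<close>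

lemma jacobson_radical_image:
  assumes "ring R" "ring S" and h: "h \<in> ring_iso R S"
  shows "h ` jacobson_radical R = jacobson_radical S"
proof
  define g where "g = inv_into (carrier R) h"
  have g: "g \<in> ring_iso S R"
    unfolding g_def using ring_iso_set_sym[OF assms(1) h] .
  have "h ` jacobson_radical R \<subseteq> h ` g ` jacobson_radical S"
    using jacobson_radical_subset_image[OF assms(2,1) g] by (rule image_mono)
  also have "\<dots> = jacobson_radical S"
  proof -
    have "h (g y) = y" if "y \<in> carrier S" for y
      using that ring_iso_memE(5)[OF h] by (simp add: g_def bij_betw_def f_inv_into_f)
    then show ?thesis
      by (force simp: jacobson_radical_def image_iff)
  qed
  finally show "h ` jacobson_radical R \<subseteq> jacobson_radical S" .
qed (rule jacobson_radical_subset_image[OF assms])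

section \<open>Powers of ideals and their images\<close>

lemma ideals_set_simps [simp]:
  "mult (ideals_set R) = ideal_prod R"
  "one (ideals_set R) = carrier R"
  by (simp_all add: ideals_set_def)

lemma (in ring) ideals_set_pow_subset_carrier:
  assumes "I \<subseteq> carrier R"
  shows "I [^]\<^bsub>ideals_set R\<^esub> (m::nat) \<subseteq> carrier R"
proof (induction m)
  case (Suc m)
  have "s \<in> carrier R" if "s \<in> ideal_prod R (I [^]\<^bsub>ideals_set R\<^esub> m) I" for s
    using that by induction (use Suc assms in auto)
  then show ?case by auto
qed simp

lemma (in ring) zero_in_ideals_set_pow:
  assumes "\<zero> \<in> I"
  shows "\<zero> \<in> I [^]\<^bsub>ideals_set R\<^esub> (m::nat)"
proof (induction m)
  case (Suc m)
  then have "\<zero> \<otimes> \<zero> \<in> ideal_prod R (I [^]\<^bsub>ideals_set R\<^esub> m) I"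
    using assms by (rule ideal_prod.prod)
  then show ?case by simp
qed simp

lemma ideals_set_pow_image_subset:
  assumes "ring R" "ring S" "h \<in> ring_iso R S" "I \<subseteq> carrier R"
  shows "h ` (I [^]\<^bsub>ideals_set R\<^esub> (m::nat)) \<subseteq> (h ` I) [^]\<^bsub>ideals_set S\<^esub> m"
proof (induction m)
  case 0
  then show ?case using ring_iso_memE(1)[OF assms(3)] by auto
next
  case (Suc m)
  have carr: "I [^]\<^bsub>ideals_set R\<^esub> k \<subseteq> carrier R" for k :: nat
    using ring.ideals_set_pow_subset_carrier assms(1,4) by blast
  \<comment> \<open>\<open>ideal_prod\<close> is generated by products and sums, so rule induction
    applies. The first conjunct keeps the summands in the carrier, where \<open>h\<close> is
    additive.\<close>
  have "s \<in> I [^]\<^bsub>ideals_set R\<^esub> Suc m \<and> h s \<in> ideal_prod S ((h ` I) [^]\<^bsub>ideals_set S\<^esub> m) (h ` I)"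
    if "s \<in> ideal_prod R (I [^]\<^bsub>ideals_set R\<^esub> m) I" for s
    using that
  proof induction
    case (prod i j)
    then have "h (i \<otimes>\<^bsub>R\<^esub> j) = h i \<otimes>\<^bsub>S\<^esub> h j"
      using carr assms(4) ring_iso_memE(2)[OF assms(3)] by blast
    then show ?case
      using prod Suc by (auto intro!: ideal_prod.prod)
  next
    case (sum s t)
    then have "h (s \<oplus>\<^bsub>R\<^esub> t) = h s \<oplus>\<^bsub>S\<^esub> h t"
      using carr[of "Suc m"] ring_iso_memE(3)[OF assms(3)] by blast
    then show ?case
      using sum by (auto intro: ideal_prod.sum)
  qed
  then show ?case by auto
qed

lemma (in ring) zero_in_jacobson_radical: "\<zero> \<in> jacobson_radical R"
  using additive_subgroup.zero_closed
  by (auto simp: jacobson_radical_def maximal_left_ideal_def left_ideal_def)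

lemma jacobson_radical_subset_carrier: "jacobson_radical R \<subseteq> carrier R"
  by (auto simp: jacobson_radical_def)

text \<open>An isomorphism carries radical to radical, hence the power in \<open>R\<close> into the
  zero power in \<open>S\<close>; injectivity then makes it zero.\<close>

lemma radical_pow_zero_transfer:
  assumes "ring R" "ring S" and h: "h \<in> ring_iso R S"
    and zero: "jacobson_radical S [^]\<^bsub>ideals_set S\<^esub> (m::nat) = {\<zero>\<^bsub>S\<^esub>}"
  shows "jacobson_radical R [^]\<^bsub>ideals_set R\<^esub> m = {\<zero>\<^bsub>R\<^esub>}"
proof -
  interpret R: ring R by fact
  interpret S: ring S by fact
  interpret h: ring_hom_ring R S h
    using assms by unfold_locales (auto simp: ring_iso_def)
  let ?P = "jacobson_radical R [^]\<^bsub>ideals_set R\<^esub> m"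
  have image: "h ` ?P \<subseteq> {\<zero>\<^bsub>S\<^esub>}"
    using ideals_set_pow_image_subset[OF assms(1,2) h jacobson_radical_subset_carrier]
      jacobson_radical_image[OF assms(1,2) h] zero by metis
  have inj: "inj_on h (carrier R)"
    using ring_iso_memE(5)[OF h] by (simp add: bij_betw_def)
  have "?P \<subseteq> {\<zero>\<^bsub>R\<^esub>}"
  proof
    fix x assume x: "x \<in> ?P"
    then have "x \<in> carrier R"
      using R.ideals_set_pow_subset_carrier[OF jacobson_radical_subset_carrier] by blast
    moreover have "h x = h \<zero>\<^bsub>R\<^esub>"
      using image x unfolding h.hom_zero by blast
    ultimately show "x \<in> {\<zero>\<^bsub>R\<^esub>}"
      using inj_onD[OF inj] R.zero_closed by blast
  qed
  then show ?thesis
    using R.zero_in_ideals_set_pow[OF R.zero_in_jacobson_radical, of m] by blast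
qed

theorem loewy_length_iso:
  assumes "ring R" "ring S" "h \<in> ring_iso R S"
  shows "loewy_length R = loewy_length S"
proof -
  have "jacobson_radical R [^]\<^bsub>ideals_set R\<^esub> m = {\<zero>\<^bsub>R\<^esub>} \<longleftrightarrow>
    jacobson_radical S [^]\<^bsub>ideals_set S\<^esub> m = {\<zero>\<^bsub>S\<^esub>}" for m :: nat
    using radical_pow_zero_transfer[OF assms]
      radical_pow_zero_transfer[OF assms(2,1) ring_iso_set_sym[OF assms(1,3)]] by blast
  then show ?thesis
    by (simp add: loewy_length_def)
qed

text \<open>If a maximal left ideal \<open>M\<close> did not contain \<open>J\<close>, then
  \<open>M + J\<close> would be the whole ring and 1 = m + j with \<open>j\<close> nilpotent.
  Expanding 1 repeatedly by this equation pushes it into \<open>M\<close>.\<close>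

lemma (in ring) nil_left_ideal_subset_jacobson_radical:
  assumes J: "left_ideal J R" and nil: "\<And>x. x \<in> J \<Longrightarrow> \<exists>k::nat. x [^] k = \<zero>"
  shows "J \<subseteq> jacobson_radical R"
proof -
  interpret J: left_ideal J R by fact
  have "J \<subseteq> M" if "maximal_left_ideal M R" for M
  proof (rule ccontr)
    assume "\<not> J \<subseteq> M"
    interpret M: maximal_left_ideal M R by fact
    have MJ: "left_ideal (M <+>\<^bsub>R\<^esub> J) R"
    proof (intro left_ideal.intro left_ideal_axioms.intro)
      show "additive_subgroup (M <+>\<^bsub>R\<^esub> J) R"
        using add_additive_subgroups M.additive_subgroup_axioms J.additive_subgroup_axioms by blast
      fix a x assume "a \<in> M <+>\<^bsub>R\<^esub> J" and x: "x \<in> carrier R"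
      then obtain m j where mj: "m \<in> M" "j \<in> J" "a = m \<oplus> j"
        by (auto simp: set_add_def set_mult_def)
      then have "x \<otimes> a = x \<otimes> m \<oplus> x \<otimes> j"
        using x M.a_Hcarr J.a_Hcarr r_distr by simp
      then show "x \<otimes> a \<in> M <+>\<^bsub>R\<^esub> J"
        using M.I_l_closed[OF mj(1) x] J.I_l_closed[OF mj(2) x]
        by (auto simp: set_add_def set_mult_def)
    qed (rule ring_axioms)
    have "M \<subseteq> M <+>\<^bsub>R\<^esub> J"
      using M.a_Hcarr J.zero_closed by (auto simp: set_add_def set_mult_def intro!: bexI[of _ \<zero>])
    moreover have "J \<subseteq> M <+>\<^bsub>R\<^esub> J"
      using J.a_Hcarr M.zero_closed by (auto simp: set_add_def set_mult_def intro!: bexI[of _ \<zero> M])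
    moreover have "M <+>\<^bsub>R\<^esub> J \<subseteq> carrier R"
      using MJ by (simp add: left_ideal_def additive_subgroup.a_subset)
    ultimately have "M <+>\<^bsub>R\<^esub> J = carrier R"
      using M.I_maximal[OF MJ] \<open>\<not> J \<subseteq> M\<close> by blast
    then have "\<one> \<in> M <+>\<^bsub>R\<^esub> J"
      by simp
    then obtain m j where mj: "m \<in> M" "j \<in> J" "\<one> = m \<oplus> j"
      by (auto simp: set_add_def set_mult_def)
    have [simp]: "m \<in> carrier R" "j \<in> carrier R"
      using mj M.a_Hcarr J.a_Hcarr by auto
    \<comment> \<open>Multiplying 1 = y + j^k by \<open>j\<close> on the left and substituting for
      \<open>j\<close> in 1 = m + j gives the next element m + j y, which stays in the left ideal
      \<open>M\<close>. At an exponent with j^k = 0 this yields 1 in \<open>M\<close>.\<close>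
    have "\<exists>y \<in> M. \<one> = y \<oplus> j [^] k" for k :: nat
    proof (induction k)
      case 0
      then show ?case using M.zero_closed by (intro bexI[of _ \<zero>]) auto
    next
      case (Suc k)
      then obtain y where y: "y \<in> M" "\<one> = y \<oplus> j [^] k" by blast
      have [simp]: "y \<in> carrier R" using y M.a_Hcarr by auto
      have "j = j \<otimes> y \<oplus> j \<otimes> j [^] k"
        using r_distr[of y "j [^] k" j] by (simp flip: y(2))
      then have "\<one> = m \<oplus> (j \<otimes> y \<oplus> j [^] Suc k)"
        using mj(3) nat_pow_Suc2[of j k] by simp
      then have "\<one> = (m \<oplus> j \<otimes> y) \<oplus> j [^] Suc k"
        by (simp add: a_assoc)
      then show ?case
        using M.a_closed[OF mj(1) M.I_l_closed[OF y(1)]] by auto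
    qed
    moreover obtain k :: nat where "j [^] k = \<zero>"
      using nil mj(2) by blast
    ultimately have "\<one> \<in> M"
      using M.a_Hcarr by (metis r_zero)
    then have "carrier R \<subseteq> M"
      using M.I_l_closed by (metis r_one subsetI)
    then show False
      using M.I_notcarr M.a_subset by blast
  qed
  then show ?thesis
    using J.a_subset by (auto simp: jacobson_radical_def)
qed

section \<open>Category algebras\<close>

locale finite_category = category +
  assumes finite_arrows: "finite (arrows C)"
begin

abbreviation composes :: "'b \<Rightarrow> 'b \<Rightarrow> 'b \<Rightarrow> bool" where
  "composes g h f \<equiv> source C g = target C h \<and> comp_mor C g h = f"

section \<open>Coefficients of products, and the ring axioms\<close>

lemma carrier_category_algebra:
  "a \<in> carrier (category_algebra K C) \<longleftrightarrow> (\<forall>f. f \<notin> arrows C \<longrightarrow> a f = 0)"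
  using finite_subset[of "{f. a f \<noteq> 0}", OF _ finite_arrows]
  by (auto simp: category_algebra_def lin_combs_def)

lemma category_algebra_simps:
  "\<zero>\<^bsub>category_algebra K C\<^esub> = (\<lambda>f. 0)"
  "\<one>\<^bsub>category_algebra K C\<^esub> = (\<lambda>f. of_bool (f \<in> ident C ` objects C))"
  "a \<oplus>\<^bsub>category_algebra K C\<^esub> b = (\<lambda>f. a f + b f)"
  by (auto simp: category_algebra_def)

text \<open>With finitely many arrows the index set can be made independent of the two factors, at
  the price of an indicator. Distributivity and exchanges of summation then become direct.\<close>

lemma mult_category_algebra:
  assumes "a \<in> carrier (category_algebra K C)" "b \<in> carrier (category_algebra K C)"
  shows "(a \<otimes>\<^bsub>category_algebra K C\<^esub> b) f =
    (\<Sum>g\<in>arrows C. \<Sum>h\<in>arrows C. of_bool (composes g h f) * (a g * b h))"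
proof -
  have "(a \<otimes>\<^bsub>category_algebra K C\<^esub> b) f =
      (\<Sum>(g, h)\<in>{(g, h). a g \<noteq> 0 \<and> b h \<noteq> 0 \<and> composes g h f}. a g * b h)"
    by (simp add: category_algebra_def)
  also have "\<dots> = (\<Sum>(g, h)\<in>arrows C \<times> arrows C. of_bool (composes g h f) * (a g * b h))"
    using assms unfolding carrier_category_algebra
    by (intro sum.mono_neutral_cong_left) (auto simp: finite_arrows)
  finally show ?thesis
    by (simp add: sum.cartesian_product)
qed

lemma mult_category_algebra_nonzero:
  assumes "(a \<otimes>\<^bsub>category_algebra K C\<^esub> b) f \<noteq> 0"
  obtains g h where "a g \<noteq> 0" "b h \<noteq> 0" "composes g h f"
proof -
  have "(\<Sum>(g, h)\<in>{(g, h). a g \<noteq> 0 \<and> b h \<noteq> 0 \<and> composes g h f}. a g * b h) \<noteq> 0"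
    using assms by (simp add: category_algebra_def)
  then obtain p where "p \<in> {(g, h). a g \<noteq> 0 \<and> b h \<noteq> 0 \<and> composes g h f}"
    by (rule sum.not_neutral_contains_not_neutral)
  then show thesis
    using that by auto
qed

lemma mult_category_algebra_closed:
  assumes "a \<in> carrier (category_algebra K C)" "b \<in> carrier (category_algebra K C)"
  shows "a \<otimes>\<^bsub>category_algebra K C\<^esub> b \<in> carrier (category_algebra K C)"
  unfolding carrier_category_algebra
proof (intro allI impI, rule ccontr)
  fix f assume f: "f \<notin> arrows C" "(a \<otimes>\<^bsub>category_algebra K C\<^esub> b) f \<noteq> 0"
  then obtain g h where "a g \<noteq> 0" "b h \<noteq> 0" "composes g h f"
    by (elim mult_category_algebra_nonzero)
  with f(1) show False
    using assms comp_closed unfolding carrier_category_algebra by blast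
qed

lemma sum_of_bool_composes:
  assumes "g \<in> arrows C" "h \<in> arrows C"
  shows "(\<Sum>f\<in>arrows C. of_bool (composes g h f) * \<phi> f) =
    (of_bool (source C g = target C h) * \<phi> (comp_mor C g h) :: 'k::field)"
proof (cases "source C g = target C h")
  case True
  then have "(\<Sum>f\<in>arrows C. of_bool (composes g h f) * \<phi> f) =
      (\<Sum>f\<in>arrows C. if comp_mor C g h = f then \<phi> f else 0)"
    by (intro sum.cong) auto
  then show ?thesis
    using True assms comp_closed by (simp add: finite_arrows)
qed simp

text \<open>Pairing a product with an arbitrary weight \<open>\<phi>\<close> removes the sum over
  composites. Suitable weights give associativity and, later, the multiplicativity of the map
  between the two algebras.\<close>

lemma sum_mult_category_algebra:
  assumes "a \<in> carrier (category_algebra K C)" "b \<in> carrier (category_algebra K C)"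
  shows "(\<Sum>f\<in>arrows C. (a \<otimes>\<^bsub>category_algebra K C\<^esub> b) f * \<phi> f) =
    (\<Sum>g\<in>arrows C. \<Sum>h\<in>arrows C.
      of_bool (source C g = target C h) * (a g * b h * \<phi> (comp_mor C g h)))"
proof -
  have "(\<Sum>f\<in>arrows C. (a \<otimes>\<^bsub>category_algebra K C\<^esub> b) f * \<phi> f) =
      (\<Sum>f\<in>arrows C. \<Sum>g\<in>arrows C. \<Sum>h\<in>arrows C. a g * b h * (of_bool (composes g h f) * \<phi> f))"
    by (simp add: mult_category_algebra[OF assms] sum_distrib_left sum_distrib_right mult_ac)
  also have "\<dots> = (\<Sum>g\<in>arrows C. \<Sum>h\<in>arrows C. \<Sum>f\<in>arrows C.
      a g * b h * (of_bool (composes g h f) * \<phi> f))"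
    by (rule trans[OF sum.swap], rule sum.cong[OF refl], rule sum.swap)
  also have "\<dots> = (\<Sum>g\<in>arrows C. \<Sum>h\<in>arrows C.
      a g * b h * (of_bool (source C g = target C h) * \<phi> (comp_mor C g h)))"
    by (intro sum.cong refl) (simp only: sum_distrib_left[symmetric] sum_of_bool_composes)
  finally show ?thesis
    by (simp add: mult_ac)
qed

lemma mult_category_algebra_assoc:
  fixes K :: "'k::field itself"
  assumes "a \<in> carrier (category_algebra K C)" "b \<in> carrier (category_algebra K C)"
    "c \<in> carrier (category_algebra K C)"
  shows "(a \<otimes>\<^bsub>category_algebra K C\<^esub> b) \<otimes>\<^bsub>category_algebra K C\<^esub> c =
    a \<otimes>\<^bsub>category_algebra K C\<^esub> (b \<otimes>\<^bsub>category_algebra K C\<^esub> c)"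
proof
  fix f
  let ?X = "arrows C"
  \<comment> \<open>The inner sum over \<open>h\<close> serves as the weight, so each bracketing
    becomes a sum over composable triples.\<close>
  have "((a \<otimes>\<^bsub>category_algebra K C\<^esub> b) \<otimes>\<^bsub>category_algebra K C\<^esub> c) f =
      (\<Sum>p\<in>?X. (a \<otimes>\<^bsub>category_algebra K C\<^esub> b) p * (\<Sum>h\<in>?X. of_bool (composes p h f) * c h))"
    by (subst mult_category_algebra)
      (simp_all add: mult_category_algebra_closed assms sum_distrib_left mult_ac)
  also have "\<dots> = (\<Sum>g\<in>?X. \<Sum>k\<in>?X. \<Sum>h\<in>?X. of_bool (source C g = target C k) *
      (a g * b k * (of_bool (composes (comp_mor C g k) h f) * c h)))"
    by (simp only: sum_mult_category_algebra[OF assms(1,2)]) (simp only: sum_distrib_left)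
  also have "\<dots> = (\<Sum>g\<in>?X. \<Sum>k\<in>?X. \<Sum>h\<in>?X. of_bool (source C k = target C h) *
      (b k * c h * (of_bool (composes g (comp_mor C k h) f) * a g)))"
  proof (intro sum.cong refl)
    fix g k h assume "g \<in> ?X" "k \<in> ?X" "h \<in> ?X"
    then have "source C g = target C k \<and> composes (comp_mor C g k) h f \<longleftrightarrow>
        source C k = target C h \<and> composes g (comp_mor C k h) f"
      using source_comp[of k g] target_comp[of h k] comp_assoc[of h k g] by auto
    then show "of_bool (source C g = target C k) *
        (a g * b k * (of_bool (composes (comp_mor C g k) h f) * c h)) =
      of_bool (source C k = target C h) *
        (b k * c h * (of_bool (composes g (comp_mor C k h) f) * a g))"
      by (auto simp: of_bool_def)
  qed
  also have "\<dots> = (\<Sum>k\<in>?X. \<Sum>h\<in>?X. \<Sum>g\<in>?X. of_bool (source C k = target C h) *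
      (b k * c h * (of_bool (composes g (comp_mor C k h) f) * a g)))"
    by (rule trans[OF sum.swap], rule sum.cong[OF refl], rule sum.swap)
  also have "\<dots> = (\<Sum>q\<in>?X. (b \<otimes>\<^bsub>category_algebra K C\<^esub> c) q *
      (\<Sum>g\<in>?X. of_bool (composes g q f) * a g))"
    by (simp only: sum_mult_category_algebra[OF assms(2,3)]) (simp only: sum_distrib_left)
  also have "\<dots> = (\<Sum>q\<in>?X. \<Sum>g\<in>?X. of_bool (composes g q f) *
      (a g * (b \<otimes>\<^bsub>category_algebra K C\<^esub> c) q))"
    by (simp add: sum_distrib_left mult_ac)
  also have "\<dots> = (a \<otimes>\<^bsub>category_algebra K C\<^esub> (b \<otimes>\<^bsub>category_algebra K C\<^esub> c)) f"
    by (subst mult_category_algebra)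
      (simp_all add: mult_category_algebra_closed assms, rule sum.swap)
  finally show "((a \<otimes>\<^bsub>category_algebra K C\<^esub> b) \<otimes>\<^bsub>category_algebra K C\<^esub> c) f =
    (a \<otimes>\<^bsub>category_algebra K C\<^esub> (b \<otimes>\<^bsub>category_algebra K C\<^esub> c)) f" .
qed

lemma one_category_algebra_closed:
  "\<one>\<^bsub>category_algebra K C\<^esub> \<in> carrier (category_algebra K C)"
  by (auto simp: carrier_category_algebra category_algebra_simps ident_closed)

lemma mult_one_category_algebra:
  assumes a: "a \<in> carrier (category_algebra K C)"
  shows "\<one>\<^bsub>category_algebra K C\<^esub> \<otimes>\<^bsub>category_algebra K C\<^esub> a = a" (is ?l)
    and "a \<otimes>\<^bsub>category_algebra K C\<^esub> \<one>\<^bsub>category_algebra K C\<^esub> = a" (is ?r)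
proof -
  let ?X = "arrows C"
  have delta: "(\<Sum>h\<in>?X. of_bool (h = f) * a h) = a f" for f
  proof -
    have "(\<Sum>h\<in>?X. of_bool (h = f) * a h) = (\<Sum>h\<in>?X. if h = f then a h else 0)"
      by (intro sum.cong) auto
    then show ?thesis
      using a by (simp add: finite_arrows carrier_category_algebra)
  qed
  have ident_unique: "(\<Sum>g\<in>?X. of_bool (P \<and> g = ident C A) * x) = of_bool P * x"
    if "A \<in> objects C" for A P and x :: "'c"
  proof -
    have "(\<Sum>g\<in>?X. of_bool (P \<and> g = ident C A) * x) =
        (\<Sum>g\<in>?X. if g = ident C A then of_bool P * x else 0)"
      by (intro sum.cong) auto
    then show ?thesis
      using that by (simp add: finite_arrows ident_closed)
  qed
  show ?l
  proof
    fix f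
    \<comment> \<open>Of all identities in the unit, only the one at the target of \<open>h\<close>
      composes with \<open>h\<close>, and it returns \<open>h\<close>; the double sum keeps a single
      term.\<close>
    have "composes g h f \<and> g \<in> ident C ` objects C \<longleftrightarrow> h = f \<and> g = ident C (target C h)"
      if "g \<in> ?X" "h \<in> ?X" for g h
      using that target_closed source_ident ident_comp by auto
    then have eq: "of_bool (composes g h f) * (of_bool (g \<in> ident C ` objects C) * a h) =
        of_bool (h = f \<and> g = ident C (target C h)) * a h" if "g \<in> ?X" "h \<in> ?X" for g h
      using that by (simp add: of_bool_conj[symmetric] mult.assoc[symmetric])
    have "(\<one>\<^bsub>category_algebra K C\<^esub> \<otimes>\<^bsub>category_algebra K C\<^esub> a) f =
        (\<Sum>g\<in>?X. \<Sum>h\<in>?X. of_bool (composes g h f) * (of_bool (g \<in> ident C ` objects C) * a h))"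
      by (simp only: mult_category_algebra[OF one_category_algebra_closed a])
        (simp only: category_algebra_simps)
    also have "\<dots> = (\<Sum>g\<in>?X. \<Sum>h\<in>?X. of_bool (h = f \<and> g = ident C (target C h)) * a h)"
      by (intro sum.cong refl eq)
    also have "\<dots> = (\<Sum>h\<in>?X. of_bool (h = f) * a h)"
      by (subst sum.swap, intro sum.cong refl ident_unique target_closed)
    finally show "(\<one>\<^bsub>category_algebra K C\<^esub> \<otimes>\<^bsub>category_algebra K C\<^esub> a) f = a f"
      by (simp only: delta)
  qed
  show ?r
  proof
    fix f
    have "composes g h f \<and> h \<in> ident C ` objects C \<longleftrightarrow> g = f \<and> h = ident C (source C g)"
      if "g \<in> ?X" "h \<in> ?X" for g h
      using that source_closed target_ident comp_ident by auto
    then have eq: "of_bool (composes g h f) * (a g * of_bool (h \<in> ident C ` objects C)) =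
        of_bool (g = f \<and> h = ident C (source C g)) * a g" if "g \<in> ?X" "h \<in> ?X" for g h
      using that by (simp add: of_bool_conj[symmetric] mult.assoc[symmetric] mult.commute[of "a g"])
    have "(a \<otimes>\<^bsub>category_algebra K C\<^esub> \<one>\<^bsub>category_algebra K C\<^esub>) f =
        (\<Sum>g\<in>?X. \<Sum>h\<in>?X. of_bool (composes g h f) * (a g * of_bool (h \<in> ident C ` objects C)))"
      by (simp only: mult_category_algebra[OF a one_category_algebra_closed])
        (simp only: category_algebra_simps)
    also have "\<dots> = (\<Sum>g\<in>?X. \<Sum>h\<in>?X. of_bool (g = f \<and> h = ident C (source C g)) * a g)"
      by (intro sum.cong refl eq)
    also have "\<dots> = (\<Sum>g\<in>?X. of_bool (g = f) * a g)"
      by (intro sum.cong refl ident_unique source_closed)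
    finally show "(a \<otimes>\<^bsub>category_algebra K C\<^esub> \<one>\<^bsub>category_algebra K C\<^esub>) f = a f"
      by (simp only: delta)
  qed
qed

theorem ring_category_algebra: "ring (category_algebra K C)"
proof (rule ringI)
  show "abelian_group (category_algebra K C)"
  proof (rule abelian_groupI)
    fix x assume x: "x \<in> carrier (category_algebra K C)"
    show "\<exists>y\<in>carrier (category_algebra K C).
        y \<oplus>\<^bsub>category_algebra K C\<^esub> x = \<zero>\<^bsub>category_algebra K C\<^esub>"
      using x by (intro bexI[of _ "\<lambda>f. - x f"])
        (auto simp: carrier_category_algebra category_algebra_simps)
  qed (auto simp: carrier_category_algebra category_algebra_simps add_ac)
  show "monoid (category_algebra K C)"
    by (rule monoidI)
      (simp_all add: mult_category_algebra_closed one_category_algebra_closed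
        mult_category_algebra_assoc mult_one_category_algebra)
  fix x y z
  assume xyz: "x \<in> carrier (category_algebra K C)" "y \<in> carrier (category_algebra K C)"
    "z \<in> carrier (category_algebra K C)"
  then have "x \<oplus>\<^bsub>category_algebra K C\<^esub> y \<in> carrier (category_algebra K C)"
    by (simp add: carrier_category_algebra category_algebra_simps)
  then show "(x \<oplus>\<^bsub>category_algebra K C\<^esub> y) \<otimes>\<^bsub>category_algebra K C\<^esub> z =
      x \<otimes>\<^bsub>category_algebra K C\<^esub> z \<oplus>\<^bsub>category_algebra K C\<^esub> y \<otimes>\<^bsub>category_algebra K C\<^esub> z"
    "z \<otimes>\<^bsub>category_algebra K C\<^esub> (x \<oplus>\<^bsub>category_algebra K C\<^esub> y) =
      z \<otimes>\<^bsub>category_algebra K C\<^esub> x \<oplus>\<^bsub>category_algebra K C\<^esub> z \<otimes>\<^bsub>category_algebra K C\<^esub> y"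
    using xyz
    by (auto simp: fun_eq_iff mult_category_algebra category_algebra_simps(3) algebra_simps
        sum.distrib)
qed

lemma uminus_category_algebra:
  assumes "a \<in> carrier (category_algebra K C)"
  shows "(\<ominus>\<^bsub>category_algebra K C\<^esub> a) f = - a f"
proof -
  interpret R: ring "category_algebra K C" by (rule ring_category_algebra)
  have "((\<ominus>\<^bsub>category_algebra K C\<^esub> a) \<oplus>\<^bsub>category_algebra K C\<^esub> a) f = 0"
    using R.l_neg[OF assms] by (simp add: category_algebra_simps)
  then show ?thesis
    by (simp add: category_algebra_simps eq_neg_iff_add_eq_0)
qed

section \<open>Basis arrows and their products\<close>

lemma basis_category_algebra:
  "f \<in> arrows C \<Longrightarrow> (\<lambda>x. of_bool (x = f)) \<in> carrier (category_algebra K C)"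
  by (auto simp: carrier_category_algebra)

lemma mult_basis_category_algebra:
  assumes "g \<in> arrows C" "h \<in> arrows C" "source C g = target C h"
  shows "(\<lambda>x. of_bool (x = g)) \<otimes>\<^bsub>category_algebra K C\<^esub> (\<lambda>x. of_bool (x = h)) =
    (\<lambda>x. of_bool (x = comp_mor C g h))"
proof
  fix f
  have "((\<lambda>x. of_bool (x = g)) \<otimes>\<^bsub>category_algebra K C\<^esub> (\<lambda>x. of_bool (x = h))) f =
      (\<Sum>g'\<in>arrows C. \<Sum>h'\<in>arrows C.
        if h' = h then (if g' = g then of_bool (composes g h f) else 0) else 0)"
    unfolding mult_category_algebra[OF basis_category_algebra basis_category_algebra, OF assms(1,2)]
    by (intro sum.cong) auto
  then show "((\<lambda>x. of_bool (x = g)) \<otimes>\<^bsub>category_algebra K C\<^esub> (\<lambda>x. of_bool (x = h))) f =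
      of_bool (f = comp_mor C g h)"
    using assms by (auto simp: finite_arrows)
qed

end

section \<open>Categories with a rank function\<close>

text \<open>The strict drop makes every endomorphism an identity and bounds the length of chains of
  composable non-identity arrows by the rank of the source.\<close>

locale ranked_category = finite_category +
  fixes rank :: "'a \<Rightarrow> nat"
  assumes rank_less:
    "\<lbrakk>f \<in> arrows C; f \<noteq> ident C (source C f)\<rbrakk> \<Longrightarrow> rank (target C f) < rank (source C f)"
begin

text \<open>A decreasing multiplicative filtration that bounds the radical powers from above. The
  additive form of the inequality avoids truncated subtraction.\<close>

definition rank_filtration :: "'k::field itself \<Rightarrow> nat \<Rightarrow> ('b \<Rightarrow> 'k) set" where
  "rank_filtration K m = {a \<in> carrier (category_algebra K C).
    \<forall>f. a f \<noteq> 0 \<longrightarrow> rank (target C f) + m \<le> rank (source C f)}"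

text \<open>Rank drops add along a composite, since the source of the left factor is the target of
  the right one.\<close>

lemma rank_filtration_mult:
  assumes "a \<in> rank_filtration K i" "b \<in> rank_filtration K j"
  shows "a \<otimes>\<^bsub>category_algebra K C\<^esub> b \<in> rank_filtration K (i + j)"
proof -
  have "rank (target C f) + (i + j) \<le> rank (source C f)"
    if f: "(a \<otimes>\<^bsub>category_algebra K C\<^esub> b) f \<noteq> 0" for f
  proof -
    obtain g h where gh: "a g \<noteq> 0" "b h \<noteq> 0" "composes g h f"
      using f by (rule mult_category_algebra_nonzero)
    moreover from this have "g \<in> arrows C" "h \<in> arrows C"
      using assms by (auto simp: rank_filtration_def carrier_category_algebra)
    ultimately have "source C f = source C h" "target C f = target C g"
      using source_comp target_comp by auto
    moreover have "rank (target C g) + i \<le> rank (source C g)"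
      "rank (target C h) + j \<le> rank (source C h)"
      using gh assms by (auto simp: rank_filtration_def)
    ultimately show ?thesis
      using gh by simp
  qed
  then show ?thesis
    using assms by (auto simp: rank_filtration_def mult_category_algebra_closed)
qed

lemma rank_filtration_add:
  assumes "a \<in> rank_filtration K i" "b \<in> rank_filtration K i"
  shows "a \<oplus>\<^bsub>category_algebra K C\<^esub> b \<in> rank_filtration K i"
  using assms
  by (auto simp: rank_filtration_def carrier_category_algebra category_algebra_simps)
    (metis add.right_neutral)

lemma rank_target_le:
  assumes "f \<in> arrows C"
  shows "rank (target C f) \<le> rank (source C f)"
  using rank_less[OF assms] target_ident[OF source_closed[OF assms]]
  by (cases "f = ident C (source C f)") auto

lemma rank_filtration_0: "carrier (category_algebra K C) = rank_filtration K 0"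
  by (auto simp: rank_filtration_def carrier_category_algebra intro!: rank_target_le)

lemma rank_filtration_eq_zero:
  assumes "\<And>A. A \<in> objects C \<Longrightarrow> rank A < m"
  shows "rank_filtration K m = {\<zero>\<^bsub>category_algebra K C\<^esub>}"
proof -
  have "a f = 0" if "a \<in> rank_filtration K m" for a f
  proof (rule ccontr)
    assume "a f \<noteq> 0"
    then have "rank (target C f) + m \<le> rank (source C f)" "f \<in> arrows C"
      using that by (auto simp: rank_filtration_def carrier_category_algebra)
    then show False
      using assms[OF source_closed] by fastforce
  qed
  moreover have "\<zero>\<^bsub>category_algebra K C\<^esub> \<in> rank_filtration K m"
    by (auto simp: rank_filtration_def carrier_category_algebra category_algebra_simps)
  ultimately show ?thesis
    by (auto simp: category_algebra_simps)
qed

text \<open>An arrow loses no rank exactly when it is an identity. This links the filtration, which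
  gives nilpotency, to the vanishing of identity coefficients, which comes from maximal left
  ideals.\<close>

lemma rank_filtration_1:
  "rank_filtration K 1 =
    {a \<in> carrier (category_algebra K C). \<forall>A\<in>objects C. a (ident C A) = 0}"
proof -
  have "rank (target C f) + 1 \<le> rank (source C f)"
    if "a \<in> carrier (category_algebra K C)" "\<forall>A\<in>objects C. a (ident C A) = 0" "a f \<noteq> 0" for a f
  proof -
    have f: "f \<in> arrows C"
      using that by (auto simp: carrier_category_algebra)
    then have "f \<noteq> ident C (source C f)"
      using source_closed that by metis
    then show ?thesis
      using rank_less f by fastforce
  qed
  moreover have "a (ident C A) = 0"
    if "A \<in> objects C" "a \<in> rank_filtration K 1" for A a
  proof (rule ccontr)
    assume "a (ident C A) \<noteq> 0"
    with that(2) have "rank (target C (ident C A)) + 1 \<le> rank (source C (ident C A))"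
      unfolding rank_filtration_def by blast
    then show False
      by (simp add: that source_ident target_ident)
  qed
  ultimately show ?thesis
    unfolding rank_filtration_def by blast
qed

text \<open>Rank cannot rise along an arrow, so a factorization of an identity loses none at either
  factor, and both factors are identities.\<close>

lemma composes_ident_iff:
  assumes "A \<in> objects C" "g \<in> arrows C" "h \<in> arrows C"
  shows "composes g h (ident C A) \<longleftrightarrow> g = ident C A \<and> h = ident C A"
proof
  assume gh: "composes g h (ident C A)"
  then have A: "source C h = A" "target C g = A"
    using assms source_comp[of h g] target_comp[of h g] source_ident target_ident by auto
  have "h = ident C A"
  proof (rule ccontr)
    assume "h \<noteq> ident C A"
    then have "rank (target C h) < rank A"
      using rank_less[OF assms(3)] A by simp
    then show False
      using rank_target_le[OF assms(2)] gh A by simp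
  qed
  then have "source C g = A"
    using gh assms(1) target_ident by simp
  then have "g = ident C A"
    using rank_less[OF assms(2)] A by auto
  then show "g = ident C A \<and> h = ident C A"
    using \<open>h = ident C A\<close> by simp
next
  assume "g = ident C A \<and> h = ident C A"
  then show "composes g h (ident C A)"
    using assms source_ident target_ident comp_ident[of "ident C A"] by auto
qed

text \<open>As an identity factors only trivially, its coefficient is an algebra homomorphism to the
  field. These homomorphisms are the coordinates of the semisimple quotient.\<close>

lemma mult_category_algebra_ident:
  assumes "A \<in> objects C" "a \<in> carrier (category_algebra K C)" "b \<in> carrier (category_algebra K C)"
  shows "(a \<otimes>\<^bsub>category_algebra K C\<^esub> b) (ident C A) = a (ident C A) * b (ident C A)"
proof -
  have "(a \<otimes>\<^bsub>category_algebra K C\<^esub> b) (ident C A) =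
      (\<Sum>g\<in>arrows C. \<Sum>h\<in>arrows C.
        if h = ident C A then (if g = ident C A then a g * b h else 0) else 0)"
    unfolding mult_category_algebra[OF assms(2,3)]
    by (intro sum.cong refl) (simp add: composes_ident_iff assms(1))
  then show ?thesis
    using ident_closed[OF assms(1)] by (simp add: finite_arrows)
qed

text \<open>This is the kernel of the coefficient homomorphism onto the field, so it has codimension
  one.\<close>

lemma maximal_left_ideal_coeff_ident:
  assumes A: "A \<in> objects C"
  shows "maximal_left_ideal {a \<in> carrier (category_algebra K C). a (ident C A) = 0}
    (category_algebra K C)" (is "maximal_left_ideal ?M ?R")
proof -
  interpret R: ring ?R by (rule ring_category_algebra)
  let ?i = "ident C A"
  have add: "(a \<oplus>\<^bsub>?R\<^esub> b) f = a f + b f" for a b f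
    by (simp add: category_algebra_simps)
  have one: "\<one>\<^bsub>?R\<^esub> ?i = 1"
    unfolding category_algebra_simps using A by simp
  have "subgroup ?M (add_monoid ?R)"
  proof (rule R.add.subgroupI)
    show "?M \<noteq> {}"
      using R.zero_closed by (auto simp: category_algebra_simps)
  qed (auto simp: add uminus_category_algebra)
  then have M: "left_ideal ?M ?R"
    using R.ring_axioms
    by (auto simp: left_ideal_def left_ideal_axioms_def additive_subgroup_def
        mult_category_algebra_closed mult_category_algebra_ident[OF A])
  show ?thesis
  proof (intro maximal_left_ideal.intro M maximal_left_ideal_axioms.intro)
    have "\<one>\<^bsub>?R\<^esub> \<notin> ?M"
      using one by simp
    then show "carrier ?R \<noteq> ?M"
      using R.one_closed by metis
  next
    fix J assume J: "left_ideal J ?R" "?M \<subseteq> J" "J \<subseteq> carrier ?R"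
    interpret J: left_ideal J ?R by (rule J)
    have "carrier ?R \<subseteq> J" if neq: "J \<noteq> ?M"
    proof
      fix y assume y: "y \<in> carrier ?R"
      obtain x where x: "x \<in> J" "x ?i \<noteq> 0"
        using J neq by blast
      have xR [simp]: "x \<in> carrier ?R"
        using x J by blast
      \<comment> \<open>The multiple of the identity for which \<open>r\<close> times
        \<open>x\<close> has the same coefficient at \<open>?i\<close> as \<open>y\<close>; the
        difference then lies in \<open>?M\<close>, hence in \<open>J\<close>.\<close>
      define r where "r = (\<lambda>f. of_bool (f = ?i) * (y ?i / x ?i))"
      have r: "r \<in> carrier ?R"
        using ident_closed[OF A] by (auto simp: r_def carrier_category_algebra)
      have "(y \<ominus>\<^bsub>?R\<^esub> r \<otimes>\<^bsub>?R\<^esub> x) ?i = 0"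
        using x(2) r y by (simp add: a_minus_def add uminus_category_algebra mult_category_algebra_ident[OF A] r_def)
      then have "y \<ominus>\<^bsub>?R\<^esub> r \<otimes>\<^bsub>?R\<^esub> x \<in> J"
        using J(2) r y by auto
      moreover have "r \<otimes>\<^bsub>?R\<^esub> x \<in> J"
        using J.I_l_closed x r by blast
      ultimately have "(y \<ominus>\<^bsub>?R\<^esub> r \<otimes>\<^bsub>?R\<^esub> x) \<oplus>\<^bsub>?R\<^esub> r \<otimes>\<^bsub>?R\<^esub> x \<in> J"
        by (rule J.a_closed)
      then show "y \<in> J"
        using r y by (simp add: a_minus_def R.a_assoc R.l_neg)
    qed
    then show "J = ?M \<or> J = carrier ?R"
      using J(3) by blast
  qed
qed

section \<open>The radical, its powers and the Loewy length\<close>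

lemma rank_bounded: "\<exists>N. \<forall>A\<in>objects C. rank A < N"
proof -
  \<comment> \<open>Distinct objects have distinct identities, so finitely many arrows leave only
    finitely many objects.\<close>
  have "inj_on (ident C) (objects C)"
    by (metis inj_onI source_ident)
  moreover have "ident C ` objects C \<subseteq> arrows C"
    using ident_closed by blast
  ultimately have "finite (objects C)"
    using finite_arrows finite_subset finite_imageD by blast
  then show ?thesis
    by (intro exI[of _ "Suc (Max (rank ` objects C))"]) (auto simp: less_Suc_eq_le)
qed

text \<open>The kernels of the identity coefficients bound the radical from above. Conversely, the
  first filtration step is a left ideal whose elements are nilpotent, because their k-th powers lie
  in step k and ranks are bounded.\<close>

lemma jacobson_radical_category_algebra:
  "jacobson_radical (category_algebra K C) = rank_filtration K 1" (is "jacobson_radical ?R = _")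
proof
  show "jacobson_radical ?R \<subseteq> rank_filtration K 1"
    using maximal_left_ideal_coeff_ident[where K = K]
    unfolding rank_filtration_1 jacobson_radical_def by blast
next
  interpret R: ring ?R by (rule ring_category_algebra)
  obtain N where N: "\<And>A. A \<in> objects C \<Longrightarrow> rank A < N"
    using rank_bounded by blast
  show "rank_filtration K 1 \<subseteq> jacobson_radical ?R"
  proof (rule R.nil_left_ideal_subset_jacobson_radical)
    have "left_ideal_axioms (rank_filtration K 1) ?R"
    proof
      fix a x assume "a \<in> rank_filtration K 1" "x \<in> carrier ?R"
      then show "x \<otimes>\<^bsub>?R\<^esub> a \<in> rank_filtration K 1"
        using rank_filtration_mult[of x K 0 a 1] by (simp add: rank_filtration_0)
    qed
    moreover have "subgroup (rank_filtration K 1) (add_monoid ?R)"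
    proof (rule R.add.subgroupI)
      show "rank_filtration K 1 \<noteq> {}"
        using R.zero_closed by (auto simp: rank_filtration_def category_algebra_simps)
    next
      fix a assume a: "a \<in> rank_filtration K 1"
      then have aR: "a \<in> carrier ?R"
        by (simp add: rank_filtration_def)
      then show "\<ominus>\<^bsub>?R\<^esub> a \<in> rank_filtration K 1"
        using a R.a_inv_closed[OF aR] by (simp add: rank_filtration_def uminus_category_algebra)
    qed (auto simp: rank_filtration_add, auto simp: rank_filtration_def)
    ultimately show "left_ideal (rank_filtration K 1) ?R"
      using R.ring_axioms by (simp add: left_ideal_def additive_subgroup_def)
  next
    fix x assume x: "x \<in> rank_filtration K 1"
    have "x [^]\<^bsub>?R\<^esub> k \<in> rank_filtration K k" for k :: nat
    proof (induction k)
      case 0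
      then show ?case using R.one_closed by (simp add: rank_filtration_0)
    next
      case (Suc k)
      then show ?case using rank_filtration_mult[OF Suc x] by simp
    qed
    then show "\<exists>k::nat. x [^]\<^bsub>?R\<^esub> k = \<zero>\<^bsub>?R\<^esub>"
      using rank_filtration_eq_zero[OF N] by blast
  qed
qed

lemma radical_pow_subset_rank_filtration:
  "jacobson_radical (category_algebra K C) [^]\<^bsub>ideals_set (category_algebra K C)\<^esub> (m::nat)
    \<subseteq> rank_filtration K m"
proof (induction m)
  case 0
  then show ?case by (simp add: rank_filtration_0)
next
  case (Suc m)
  let ?R = "category_algebra K C"
  have "s \<in> rank_filtration K (Suc m)"
    if "s \<in> ideal_prod ?R (jacobson_radical ?R [^]\<^bsub>ideals_set ?R\<^esub> m) (jacobson_radical ?R)" for s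
    using that
  proof induction
    case (prod i j)
    then have "i \<in> rank_filtration K m" "j \<in> rank_filtration K 1"
      using Suc jacobson_radical_category_algebra by auto
    then show ?case using rank_filtration_mult by fastforce
  qed (rule rank_filtration_add)
  then show ?case by auto
qed

lemma basis_in_jacobson_radical:
  assumes "f \<in> arrows C" "f \<noteq> ident C (source C f)"
  shows "(\<lambda>x. of_bool (x = f)) \<in> jacobson_radical (category_algebra K C)"
  using rank_less[OF assms] basis_category_algebra[OF assms(1)]
  by (auto simp: jacobson_radical_category_algebra rank_filtration_def)

text \<open>The rank bound kills filtration step \<open>N + 1\<close>, while the witness
  \<open>a\<close> keeps the \<open>N\<close>-th radical power nonzero.\<close>

theorem loewy_length_category_algebra:
  assumes N: "\<And>A. A \<in> objects C \<Longrightarrow> rank A \<le> N"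
    and a: "a \<in> jacobson_radical (category_algebra K C) [^]\<^bsub>ideals_set (category_algebra K C)\<^esub> N"
      "a \<noteq> \<zero>\<^bsub>category_algebra K C\<^esub>"
  shows "loewy_length (category_algebra K C) = N + 1"
  unfolding loewy_length_def
proof (rule Least_equality)
  let ?R = "category_algebra K C"
  let ?P = "\<lambda>m::nat. jacobson_radical ?R [^]\<^bsub>ideals_set ?R\<^esub> m"
  interpret R: ring ?R by (rule ring_category_algebra)
  have "rank_filtration K (N + 1) = {\<zero>\<^bsub>?R\<^esub>}"
    using N by (intro rank_filtration_eq_zero) (simp add: less_Suc_eq_le)
  then show "?P (N + 1) = {\<zero>\<^bsub>?R\<^esub>}"
    using radical_pow_subset_rank_filtration[of K "N + 1"]
      R.zero_in_ideals_set_pow[OF R.zero_in_jacobson_radical, of "N + 1"] by blast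
  fix m assume m: "?P m = {\<zero>\<^bsub>?R\<^esub>}"
  show "N + 1 \<le> m"
  proof (rule ccontr)
    assume "\<not> N + 1 \<le> m"
    then have "m \<le> N" by simp
    \<comment> \<open>A vanishing power makes all later powers vanish, so an exponent up to
      \<open>N\<close> would contradict the witness \<open>a\<close>.\<close>
    then have "?P N \<subseteq> {\<zero>\<^bsub>?R\<^esub>}"
    proof (induction rule: dec_induct)
      case base
      then show ?case using m by simp
    next
      case (step k)
      have "s = \<zero>\<^bsub>?R\<^esub>" if "s \<in> ideal_prod ?R (?P k) (jacobson_radical ?R)" for s
        using that
      proof induction
        case (prod i j)
        then have "i = \<zero>\<^bsub>?R\<^esub>" "j \<in> carrier ?R"
          using step.IH subsetD[OF jacobson_radical_subset_carrier] by auto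
        then show ?case by simp
      qed simp
      then show ?case by auto
    qed
    then show False
      using a by blast
  qed
qed

end

section \<open>The Loewy length of the category algebra of EF\<close>

lemma EF_simps [simp]:
  "objects (EF n) = Pow {1..n}"
  "source (EF n) = dom"
  "target (EF n) = ran"
  "ident (EF n) = id_on_set"
  "comp_mor (EF n) = (\<circ>\<^sub>m)"
  by (simp_all add: EF_def)

lemma arrows_EF:
  "arrows (EF n) = {f. dom f \<subseteq> {1..n} \<and> ran f \<subseteq> {1..n} \<and> order_decreasing f}"
  by (auto simp: EF_def EF_hom_def)

lemma finite_arrows_EF: "finite (arrows (EF n))"
proof (rule finite_subset)
  show "arrows (EF n) \<subseteq> (\<Union>A\<in>Pow {1..n}. {f. dom f = A \<and> ran f \<subseteq> {1..n}})"
    by (auto simp: arrows_EF)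
  show "finite (\<Union>A\<in>Pow {1..n}. {f. dom f = A \<and> ran f \<subseteq> {1..n}})"
    using finite_subset by (intro finite_UN_I finite_set_of_finite_maps) auto
qed

text \<open>The weight of 1 is 0, so merging 2 into an existing 1 costs only one unit; sharpness of
  the bound rests on this.\<close>

definition shift_sum :: "nat set \<Rightarrow> nat" where
  "shift_sum A = (\<Sum>x\<in>A. x - 1)"

text \<open>Identifying points can only decrease the sum over the image, and each surviving weight
  is at most that of its preimage, strictly at a moved point.\<close>

lemma shift_sum_ran_less:
  assumes f: "f \<in> arrows (EF n)" and "f \<noteq> id_on_set (dom f)"
  shows "shift_sum (ran f) < shift_sum (dom f)"
proof -
  have fin: "finite (dom f)"
    using f finite_subset by (auto simp: arrows_EF)
  obtain x where x: "x \<in> dom f" "f x \<noteq> Some x"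
    using assms(2) by (auto simp: fun_eq_iff id_on_set_apply split: if_splits)
  have le: "the (f y) \<le> y" "1 \<le> the (f y)" if "y \<in> dom f" for y
    using that f by (auto simp: arrows_EF order_decreasing_def ran_def)
  have "ran f = (\<lambda>y. the (f y)) ` dom f"
    by (force simp: ran_def)
  then have "shift_sum (ran f) \<le> (\<Sum>y\<in>dom f. the (f y) - 1)"
    using sum_image_le[OF fin, of "\<lambda>y. y - 1" "\<lambda>y. the (f y)"] by (simp add: shift_sum_def o_def)
  also have "\<dots> < shift_sum (dom f)"
    unfolding shift_sum_def
  proof (rule sum_strict_mono_ex1[OF fin])
    \<comment> \<open>Values are at least 1, so the truncated subtraction preserves
      strictness.\<close>
    have "the (f x) - 1 < x - 1"
      using x le[OF x(1)] by (auto simp: domIff)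
    then show "\<exists>y\<in>dom f. the (f y) - 1 < y - 1"
      using x by blast
  qed (use le in \<open>auto intro: diff_le_mono\<close>)
  finally show ?thesis .
qed

interpretation EF: ranked_category "EF n" shift_sum for n
proof -
  interpret category "EF n" by (rule category_EF)
  show "ranked_category (EF n) shift_sum"
    by unfold_locales (simp_all add: finite_arrows_EF shift_sum_ran_less)
qed

section \<open>The maximal rank and the sharpness of the bound\<close>

lemma shift_sum_atLeastAtMost: "shift_sum {1..n} = n choose 2"
  by (induction n) (simp_all add: shift_sum_def numeral_2_eq_2)

lemma shift_sum_le:
  assumes "A \<subseteq> {1..n}"
  shows "shift_sum A \<le> n choose 2"
  unfolding shift_sum_atLeastAtMost[symmetric] unfolding shift_sum_def
  using assms by (intro sum_mono2) auto

text \<open>For nonempty \<open>A\<close> the image has rank 0, so this arrow spends the entire rank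
  of \<open>A\<close>; it is the witness for a nonzero radical power.\<close>

definition const_one :: "nat set \<Rightarrow> nat \<rightharpoonup> nat" where
  "const_one A = (\<lambda>x. if x \<in> A then Some 1 else None)"

lemma dom_const_one [simp]: "dom (const_one A) = A"
  by (auto simp: const_one_def dom_def)

lemma const_one_EF:
  assumes "A \<subseteq> {1..n}" "A \<noteq> {}"
  shows "const_one A \<in> arrows (EF n)"
proof -
  obtain x where "x \<in> A" using assms(2) by blast
  then have "1 \<le> n" using assms(1) by fastforce
  then show ?thesis
    using assms by (auto simp: arrows_EF const_one_def ran_def order_decreasing_def split: if_splits)
qed

text \<open>
  Lowering the least element \<open>j > 1\<close> of \<open>A\<close> to \<open>j - 1\<close> costs exactly one unit of \<open>shift_sum\<close>:
  if \<open>j - 1\<close> already lies in \<open>A\<close>, then \<open>j - 1 = 1\<close>, which has weight \<open>0\<close>.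
\<close>

lemma EF_lowering_step:
  assumes A: "A \<subseteq> {1..n}" and pos: "shift_sum A > 0"
  obtains B s where "s \<in> arrows (EF n)" "dom s = A" "ran s = B" "s \<noteq> id_on_set A"
    "B \<subseteq> {1..n}" "shift_sum A = Suc (shift_sum B)" "const_one B \<circ>\<^sub>m s = const_one A"
proof -
  have fin: "finite A"
    using A finite_subset by blast
  \<comment> \<open>The elements 0 and 1 have weight 0, so a positive sum needs a larger
    one.\<close>
  have "\<exists>x\<in>A. 2 \<le> x"
    using pos unfolding shift_sum_def by (rule contrapos_pp) (force simp: not_le intro!: sum.neutral)
  define j where "j = Min {x \<in> A. 2 \<le> x}"
  have "j \<in> {x \<in> A. 2 \<le> x}"
    unfolding j_def using fin \<open>\<exists>x\<in>A. 2 \<le> x\<close> by (intro Min_in) auto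
  then have j: "j \<in> A" "2 \<le> j" by auto
  have j_min: "j \<le> x" if "x \<in> A" "2 \<le> x" for x
    unfolding j_def using fin that by (intro Min_le) auto
  define B where "B = insert (j - 1) (A - {j})"
  define s where "s = (\<lambda>x. if x \<in> A then Some (if x = j then j - 1 else x) else None)"
  have dom: "dom s = A"
    by (auto simp: s_def dom_def)
  have ran: "ran s = B"
    using j by (auto simp: s_def B_def ran_def split: if_splits)
  have B: "B \<subseteq> {1..n}"
    using A j by (auto simp: B_def)
  have "s \<in> arrows (EF n)"
    using A B dom ran by (auto simp: arrows_EF order_decreasing_def s_def)
  moreover have "s \<noteq> id_on_set A"
    using j by (auto simp: fun_eq_iff s_def id_on_set_apply intro!: exI[of _ j])
  moreover have "shift_sum A = Suc (shift_sum B)"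
  proof -
    have A_eq: "shift_sum A = (j - 1) + shift_sum (A - {j})"
      using fin j by (simp add: shift_sum_def sum.remove)
    show ?thesis
    proof (cases "j - 1 \<in> A")
      case True
      then have "j = 2"
        using j j_min[of "j - 1"] by fastforce
      moreover have "B = A - {j}"
        using True j by (auto simp: B_def)
      ultimately show ?thesis
        using A_eq by simp
    next
      case False
      then have "shift_sum B = (j - 2) + shift_sum (A - {j})"
        using fin by (simp add: B_def shift_sum_def numeral_2_eq_2)
      then show ?thesis
        using A_eq j by simp
    qed
  qed
  moreover have "const_one B \<circ>\<^sub>m s = const_one A"
    using ran by (auto simp: fun_eq_iff const_one_def map_comp_def s_def B_def)
  ultimately show thesis
    using that dom ran B by blast
qed

text \<open>Induction on the rank: the collapse of \<open>A\<close> is the collapse of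
  \<open>B\<close> after a lowering step, and each such step is a non-identity arrow, contributing
  one factor from the radical.\<close>

lemma const_one_in_radical_pow:
  assumes "A \<subseteq> {1..n}" "A \<noteq> {}"
  shows "(\<lambda>x. of_bool (x = const_one A)) \<in>
    jacobson_radical (category_algebra K (EF n)) [^]\<^bsub>ideals_set (category_algebra K (EF n))\<^esub> shift_sum A"
  using assms
proof (induction "shift_sum A" arbitrary: A)
  case 0
  \<comment> \<open>At rank 0 the power has exponent 0 and is the whole algebra.\<close>
  then show ?case
    using EF.basis_category_algebra[OF const_one_EF] by (simp flip: 0(1))
next
  case (Suc m)
  let ?R = "category_algebra K (EF n)"
  obtain B s where s: "s \<in> arrows (EF n)" "dom s = A" "ran s = B" "s \<noteq> id_on_set A"
    "B \<subseteq> {1..n}" "shift_sum A = Suc (shift_sum B)" "const_one B \<circ>\<^sub>m s = const_one A"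
    using EF_lowering_step[OF Suc(3)] Suc(2) by (metis zero_less_Suc)
  have B: "m = shift_sum B" "B \<noteq> {}"
    using s Suc(2,4) by (simp, metis domD ex_in_conv ranI)
  have "(\<lambda>x. of_bool (x = s)) \<in> jacobson_radical ?R"
    using EF.basis_in_jacobson_radical[of s n] s by simp
  moreover have "(\<lambda>x. of_bool (x = const_one B)) \<in> jacobson_radical ?R [^]\<^bsub>ideals_set ?R\<^esub> m"
    using Suc(1)[OF B(1) s(5) B(2)] B(1) by simp
  ultimately have "(\<lambda>x. of_bool (x = const_one B)) \<otimes>\<^bsub>?R\<^esub> (\<lambda>x. of_bool (x = s)) \<in>
      jacobson_radical ?R [^]\<^bsub>ideals_set ?R\<^esub> Suc m"
    by (auto intro: ideal_prod.prod)
  then show ?case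
    using EF.mult_basis_category_algebra[of "const_one B" n s K] const_one_EF[OF s(5) B(2)] s Suc(2)
    by simp
qed

theorem loewy_length_EF:
  assumes "n \<ge> 1"
  shows "loewy_length (category_algebra K (EF n)) = (n choose 2) + 1"
proof (rule EF.loewy_length_category_algebra)
  show "(\<lambda>x. of_bool (x = const_one {1..n})) \<in> jacobson_radical (category_algebra K (EF n))
      [^]\<^bsub>ideals_set (category_algebra K (EF n))\<^esub> (n choose 2)"
    \<comment> \<open>The assumption \<open>n \<ge> 1\<close> makes the full set nonempty, as
      required for its collapse to have value 1 in the range.\<close>
    using const_one_in_radical_pow[of "{1..n}" n K] assms
    unfolding shift_sum_atLeastAtMost by simp
  show "(\<lambda>x. of_bool (x = const_one {1..n})) \<noteq> \<zero>\<^bsub>category_algebra K (EF n)\<^esub>"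
    by (auto simp: EF.category_algebra_simps fun_eq_iff)
qed (simp add: shift_sum_le)

section \<open>The monoid algebra of PF\<close>

text \<open>Viewing a monoid as a category with one object lets the results on category algebras
  serve for monoid algebras too.\<close>

definition monoid_category :: "('x, 'c) monoid_scheme \<Rightarrow> (unit, 'x) cat" where
  "monoid_category M =
    \<lparr> objects = UNIV,
      arrows = carrier M,
      source = (\<lambda>_. ()),
      target = (\<lambda>_. ()),
      ident = (\<lambda>_. \<one>\<^bsub>M\<^esub>),
      comp_mor = mult M \<rparr>"

lemma category_monoid_category: "monoid M \<Longrightarrow> category (monoid_category M)"
  by unfold_locales
    (auto simp: monoid_category_def monoid.m_closed monoid.m_assoc monoid.l_one monoid.r_one
      monoid.one_closed)

lemma monoid_algebra_eq_category_algebra: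
  "monoid_algebra K M = category_algebra K (monoid_category M)"
  by (simp add: monoid_algebra_def category_algebra_def monoid_category_def)

text \<open>Both algebras thus share their underlying vector space and differ only in product and
  unit.\<close>

lemma carrier_PF_eq_arrows_EF: "carrier (PF n) = arrows (EF n)"
  by (simp add: PF_def arrows_EF)

lemma monoid_category_PF_simps [simp]:
  "objects (monoid_category (PF n)) = UNIV"
  "arrows (monoid_category (PF n)) = arrows (EF n)"
  "source (monoid_category (PF n)) f = ()"
  "target (monoid_category (PF n)) f = ()"
  "ident (monoid_category (PF n)) u = id_on_set {1..n}"
  "comp_mor (monoid_category (PF n)) = (\<circ>\<^sub>m)"
  by (simp_all add: monoid_category_def carrier_PF_eq_arrows_EF) (simp_all add: PF_def)

interpretation PF: finite_category "monoid_category (PF n)" for n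
proof -
  interpret category "monoid_category (PF n)"
    using monoid_PF by (rule category_monoid_category)
  show "finite_category (monoid_category (PF n))"
    by unfold_locales (simp add: finite_arrows_EF)
qed

text \<open>The system is unitriangular for the rank \<open>r\<close>. Elements are inserted by
  decreasing \<open>r\<close>, hence the negated ranking: the unknown at a new \<open>x\<close>
  enters no earlier equation, so those remain solved.\<close>

lemma zeta_transform_surj:
  fixes b :: "'a \<Rightarrow> 'k::ring_1" and r :: "'a \<Rightarrow> nat"
  assumes "finite X" "\<And>x. x \<in> X \<Longrightarrow> leq x x"
    and "\<And>x y. \<lbrakk>x \<in> X; y \<in> X; leq x y; x \<noteq> y\<rbrakk> \<Longrightarrow> r x < r y"
  shows "\<exists>a. (\<forall>f. f \<notin> X \<longrightarrow> a f = 0) \<and> (\<forall>m\<in>X. (\<Sum>f\<in>X. of_bool (leq m f) * a f) = b m)"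
  using assms
proof (induction X rule: finite_ranking_induct[where f = "\<lambda>x. - int (r x)"])
  case (insert x S)
  show ?case
  proof (cases "x \<in> S")
    case True
    then show ?thesis using insert by (simp add: insert_absorb)
  next
    case False
    obtain a where a: "\<forall>f. f \<notin> S \<longrightarrow> a f = 0"
      "\<forall>m\<in>S. (\<Sum>f\<in>S. of_bool (leq m f) * a f) = b m"
      using insert.IH insert.prems by blast
    \<comment> \<open>The equation at \<open>x\<close> contains the new unknown with coefficient 1,
      by reflexivity, and is solved for it.\<close>
    define a' where "a' = a(x := b x - (\<Sum>f\<in>S. of_bool (leq x f) * a f))"
    have sum_eq: "(\<Sum>f\<in>S. of_bool (leq m f) * a' f) = (\<Sum>f\<in>S. of_bool (leq m f) * a f)" for m
      using False by (intro sum.cong) (auto simp: a'_def)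
    have "\<not> leq m x" if "m \<in> S" for m
      using insert.hyps(2)[OF that] insert.prems(2)[of m x] that False by fastforce
    then have "(\<Sum>f\<in>insert x S. of_bool (leq m f) * a' f) = b m" if "m \<in> insert x S" for m
      using that a(2) insert.prems(1)[of x] False
      unfolding sum.insert[OF insert.hyps(1) False] sum_eq by (cases "m = x") (auto simp: a'_def)
    moreover have "\<forall>f. f \<notin> insert x S \<longrightarrow> a' f = 0"
      using a(1) by (simp add: a'_def)
    ultimately show ?thesis by blast
  qed
qed auto

text \<open>The same elimination order: the equations at earlier elements do not involve the new
  unknown, so the old unknowns vanish first and the equation at \<open>x\<close> then kills the last
  one.\<close>

lemma zeta_transform_inj:
  fixes a :: "'a \<Rightarrow> 'k::ring_1" and r :: "'a \<Rightarrow> nat"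
  assumes "finite X" "\<And>x. x \<in> X \<Longrightarrow> leq x x"
    and "\<And>x y. \<lbrakk>x \<in> X; y \<in> X; leq x y; x \<noteq> y\<rbrakk> \<Longrightarrow> r x < r y"
    and "\<And>m. m \<in> X \<Longrightarrow> (\<Sum>f\<in>X. of_bool (leq m f) * a f) = 0"
  shows "\<forall>f\<in>X. a f = 0"
  using assms
proof (induction X rule: finite_ranking_induct[where f = "\<lambda>x. - int (r x)"])
  case (insert x S)
  show ?case
  proof (cases "x \<in> S")
    case True
    then show ?thesis using insert by (simp add: insert_absorb)
  next
    case False
    have "\<not> leq m x" if "m \<in> S" for m
      using insert.hyps(2)[OF that] insert.prems(2)[of m x] that False by fastforce
    then have "(\<Sum>f\<in>S. of_bool (leq m f) * a f) = 0" if "m \<in> S" for m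
      using that insert.prems(3)[of m] insert.hyps(1) False by simp
    then have S: "\<forall>f\<in>S. a f = 0"
      using insert.IH insert.prems(1,2) by blast
    then show ?thesis
      using insert.prems(1,3)[of x] insert.hyps(1) False by simp
  qed
qed simp

section \<open>Restrictions of a composite and their factorizations\<close>

lemma map_le_imp_restrict: "q \<subseteq>\<^sub>m k \<Longrightarrow> q = k |` dom q"
  by (auto simp: fun_eq_iff map_le_def restrict_map_def domIff)

text \<open>
  A restriction of \<open>g \<circ>\<^sub>m k\<close> factors in exactly one way, within the category, through
  restrictions of \<open>g\<close> and \<open>k\<close>.
\<close>

lemma map_comp_factor_iff:
  "dom p = ran q \<and> p \<circ>\<^sub>m q = m \<and> p \<subseteq>\<^sub>m g \<and> q \<subseteq>\<^sub>m k \<longleftrightarrow>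
    m \<subseteq>\<^sub>m g \<circ>\<^sub>m k \<and> q = k |` dom m \<and> p = g |` ran (k |` dom m)" (is "?l \<longleftrightarrow> ?r")
proof
  assume l: ?l
  then have "q = k |` dom m"
    using map_le_imp_restrict dom_map_comp_eq by metis
  moreover have "p = g |` ran q"
    using l map_le_imp_restrict by metis
  moreover have "m x = (g \<circ>\<^sub>m k) x" if "x \<in> dom m" for x
  proof -
    have "dom q = dom m"
      using l dom_map_comp_eq by metis
    with that obtain y where y: "q x = Some y"
      by auto
    then have "y \<in> dom p"
      using l by (auto simp: ran_def)
    then obtain z where "p y = Some z"
      by auto
    moreover from this y l have "m x = Some z"
      by auto
    moreover note y
    ultimately show ?thesis
      using l by (metis domI map_comp_simps(2) map_le_def)
  qed
  ultimately show ?r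
    by (auto simp: map_le_def)
next
  assume r: ?r
  have mx: "\<exists>y. k x = Some y \<and> g y = m x" if "x \<in> dom m" for x
  proof -
    have "m x = (g \<circ>\<^sub>m k) x"
      using r that by (auto simp: map_le_def)
    then show ?thesis
      using that by (auto simp: map_comp_def split: option.splits)
  qed
  \<comment> \<open>Restricting \<open>g\<close> to these values therefore loses none of them, which
    gives the exact match of domain and range that composition in the category demands.\<close>
  have "ran (k |` dom m) \<subseteq> dom g"
    using mx by (fastforce simp: ran_def restrict_map_def split: if_splits)
  then have "dom p = ran q"
    using r by (simp add: inf.absorb2)
  moreover have "(p \<circ>\<^sub>m q) x = m x" for x
  proof (cases "x \<in> dom m")
    case True
    then obtain y where y: "k x = Some y" "g y = m x"
      using mx by blast
    then have "y \<in> ran (k |` dom m)"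
      using True by (auto simp: ran_def restrict_map_def)
    then show ?thesis
      using r y True by (simp add: map_comp_def)
  next
    case False
    then have "q x = None"
      using r by simp
    then show ?thesis
      using False by (simp add: domIff)
  qed
  moreover have "p \<subseteq>\<^sub>m g" "q \<subseteq>\<^sub>m k"
    using r by (simp_all add: map_le_def)
  ultimately show ?l
    by blast
qed

lemma restrict_in_arrows_EF:
  assumes "f \<in> arrows (EF n)"
  shows "f |` A \<in> arrows (EF n)"
  using assms by (fastforce simp: arrows_EF order_decreasing_def ran_def restrict_map_def dom_def
      split: if_splits)

lemma map_le_in_arrows_EF: "\<lbrakk>m \<subseteq>\<^sub>m f; f \<in> arrows (EF n)\<rbrakk> \<Longrightarrow> m \<in> arrows (EF n)"
  by (metis map_le_imp_restrict restrict_in_arrows_EF)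

text \<open>Unique factorization in counting form: both sums collapse to one term, which is in range
  because restrictions of arrows are arrows.\<close>

lemma sum_factorizations:
  assumes "g \<in> arrows (EF n)" "k \<in> arrows (EF n)"
  shows "(\<Sum>p\<in>arrows (EF n). \<Sum>q\<in>arrows (EF n).
      of_bool (dom p = ran q \<and> p \<circ>\<^sub>m q = m \<and> p \<subseteq>\<^sub>m g \<and> q \<subseteq>\<^sub>m k)) =
    (of_bool (m \<subseteq>\<^sub>m g \<circ>\<^sub>m k) :: 'k::field)"
proof -
  have "(\<Sum>p\<in>arrows (EF n). \<Sum>q\<in>arrows (EF n).
      of_bool (dom p = ran q \<and> p \<circ>\<^sub>m q = m \<and> p \<subseteq>\<^sub>m g \<and> q \<subseteq>\<^sub>m k)) =
    (\<Sum>p\<in>arrows (EF n). \<Sum>q\<in>arrows (EF n). if q = k |` dom m then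
      (if p = g |` ran (k |` dom m) then of_bool (m \<subseteq>\<^sub>m g \<circ>\<^sub>m k) else 0) else (0::'k))"
    unfolding map_comp_factor_iff by (intro sum.cong refl) auto
  then show ?thesis
    using restrict_in_arrows_EF[OF assms(1)] restrict_in_arrows_EF[OF assms(2)]
    by (simp add: finite_arrows_EF)
qed

text \<open>The linear map taking each basis element to the sum of its restrictions, written on
  coefficient functions: the zeta transform of the restriction order.\<close>

definition zeta_EF :: "nat \<Rightarrow> ((nat \<rightharpoonup> nat) \<Rightarrow> 'k::field) \<Rightarrow> (nat \<rightharpoonup> nat) \<Rightarrow> 'k" where
  "zeta_EF n a = (\<lambda>m. \<Sum>f\<in>arrows (EF n). of_bool (m \<subseteq>\<^sub>m f) * a f)"

lemma zeta_EF_mult: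
  fixes K :: "'k::field itself"
  assumes a: "a \<in> carrier (category_algebra K (monoid_category (PF n)))"
    and b: "b \<in> carrier (category_algebra K (monoid_category (PF n)))"
    and za: "zeta_EF n a \<in> carrier (category_algebra K (EF n))"
    and zb: "zeta_EF n b \<in> carrier (category_algebra K (EF n))"
  shows "zeta_EF n (a \<otimes>\<^bsub>category_algebra K (monoid_category (PF n))\<^esub> b) =
    zeta_EF n a \<otimes>\<^bsub>category_algebra K (EF n)\<^esub> zeta_EF n b"
proof
  fix m
  let ?X = "arrows (EF n)"
  have "zeta_EF n (a \<otimes>\<^bsub>category_algebra K (monoid_category (PF n))\<^esub> b) m =
      (\<Sum>g\<in>?X. \<Sum>k\<in>?X. a g * b k * of_bool (m \<subseteq>\<^sub>m g \<circ>\<^sub>m k))"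
    using PF.sum_mult_category_algebra[OF a b, of "\<lambda>f. of_bool (m \<subseteq>\<^sub>m f)"]
    by (simp add: zeta_EF_def mult.commute)
  \<comment> \<open>The indicator of a restriction of the composite is replaced by its number of
    factorizations. After exchanging the pairs (g, k) and (p, q), the sums over \<open>g\<close> and
    \<open>k\<close> separate into the two transforms.\<close>
  also have "\<dots> = (\<Sum>g\<in>?X. \<Sum>k\<in>?X. \<Sum>p\<in>?X. \<Sum>q\<in>?X. a g * b k *
      of_bool (dom p = ran q \<and> p \<circ>\<^sub>m q = m \<and> p \<subseteq>\<^sub>m g \<and> q \<subseteq>\<^sub>m k))"
    by (intro sum.cong refl) (simp only: sum_factorizations[symmetric] sum_distrib_left)
  also have "\<dots> = (\<Sum>(g, k)\<in>?X \<times> ?X. \<Sum>(p, q)\<in>?X \<times> ?X. a g * b k *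
      of_bool (dom p = ran q \<and> p \<circ>\<^sub>m q = m \<and> p \<subseteq>\<^sub>m g \<and> q \<subseteq>\<^sub>m k))"
    by (simp only: sum.cartesian_product[symmetric])
  also have "\<dots> = (\<Sum>(p, q)\<in>?X \<times> ?X. \<Sum>(g, k)\<in>?X \<times> ?X. a g * b k *
      of_bool (dom p = ran q \<and> p \<circ>\<^sub>m q = m \<and> p \<subseteq>\<^sub>m g \<and> q \<subseteq>\<^sub>m k))"
    unfolding case_prod_unfold by (rule sum.swap)
  also have "\<dots> = (\<Sum>p\<in>?X. \<Sum>q\<in>?X. \<Sum>g\<in>?X. \<Sum>k\<in>?X. a g * b k *
      of_bool (dom p = ran q \<and> p \<circ>\<^sub>m q = m \<and> p \<subseteq>\<^sub>m g \<and> q \<subseteq>\<^sub>m k))"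
    by (simp only: sum.cartesian_product[symmetric])
  also have "\<dots> = (\<Sum>p\<in>?X. \<Sum>q\<in>?X. of_bool (dom p = ran q \<and> p \<circ>\<^sub>m q = m) *
      (zeta_EF n a p * zeta_EF n b q))"
    unfolding zeta_EF_def sum_product
    by (simp only: sum_distrib_left, intro sum.cong refl) (auto simp: of_bool_def)
  also have "\<dots> = (zeta_EF n a \<otimes>\<^bsub>category_algebra K (EF n)\<^esub> zeta_EF n b) m"
    by (simp add: EF.mult_category_algebra[OF za zb])
  finally show "zeta_EF n (a \<otimes>\<^bsub>category_algebra K (monoid_category (PF n))\<^esub> b) m =
    (zeta_EF n a \<otimes>\<^bsub>category_algebra K (EF n)\<^esub> zeta_EF n b) m" .
qed

lemma zeta_EF_ring_iso:
  fixes K :: "'k::field itself"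
  shows "zeta_EF n \<in>
    ring_iso (category_algebra K (monoid_category (PF n))) (category_algebra K (EF n))"
    (is "_ \<in> ring_iso ?P ?E")
proof -
  let ?X = "arrows (EF n)"
  have carrier: "carrier ?P = carrier ?E"
    by (auto simp: EF.carrier_category_algebra PF.carrier_category_algebra)
  \<comment> \<open>A map lying below an arrow is itself an arrow, so every term vanishes
    elsewhere.\<close>
  have closed: "zeta_EF n a \<in> carrier ?E" for a :: "_ \<Rightarrow> 'k"
    unfolding EF.carrier_category_algebra zeta_EF_def
    by (auto intro!: sum.neutral dest: map_le_in_arrows_EF)
  have add: "zeta_EF n (\<lambda>f. a f + b f) = (\<lambda>f. zeta_EF n a f + zeta_EF n b f)"
    for a b :: "_ \<Rightarrow> 'k"
    by (simp add: zeta_EF_def algebra_simps sum.distrib)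
  have one: "zeta_EF n \<one>\<^bsub>?P\<^esub> = \<one>\<^bsub>?E\<^esub>"
  proof
    fix m
    have id: "id_on_set {1..n} \<in> ?X"
      by (auto simp: arrows_EF order_decreasing_id)
    \<comment> \<open>The monoid unit is thereby sent to the sum of the identities of all objects,
      the unit of the category algebra.\<close>
    have "m \<subseteq>\<^sub>m id_on_set {1..n} \<longleftrightarrow> m \<in> id_on_set ` Pow {1..n}"
    proof
      assume m: "m \<subseteq>\<^sub>m id_on_set {1..n}"
      then have "dom m \<subseteq> {1..n}"
        using map_le_implies_dom_le by fastforce
      then have "id_on_set {1..n} |` dom m = id_on_set (dom m)"
        by (auto simp: fun_eq_iff id_on_set_apply restrict_map_def)
      then have "m = id_on_set (dom m)"
        using map_le_imp_restrict[OF m] by (rule trans[rotated])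
      then show "m \<in> id_on_set ` Pow {1..n}"
        using \<open>dom m \<subseteq> {1..n}\<close> by blast
    qed (auto simp: map_le_def id_on_set_apply split: if_splits)
    moreover have "zeta_EF n \<one>\<^bsub>?P\<^esub> m =
        (\<Sum>f\<in>?X. if f = id_on_set {1..n} then of_bool (m \<subseteq>\<^sub>m id_on_set {1..n}) else 0)"
      unfolding zeta_EF_def by (intro sum.cong) (auto simp: PF.category_algebra_simps)
    ultimately show "zeta_EF n \<one>\<^bsub>?P\<^esub> m = \<one>\<^bsub>?E\<^esub> m"
      using id by (simp add: finite_arrows_EF EF.category_algebra_simps)
  qed
  \<comment> \<open>A proper restriction has a smaller domain, so domain size is the rank that makes
    the transform triangular.\<close>
  have rank: "card (dom x) < card (dom y)"
    if "x \<in> ?X" "y \<in> ?X" "x \<subseteq>\<^sub>m y" "x \<noteq> y" for x y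
  proof (rule psubset_card_mono)
    show "finite (dom y)"
      using that finite_subset by (auto simp: arrows_EF)
    show "dom x \<subset> dom y"
      using that map_le_imp_restrict[OF that(3)] map_le_implies_dom_le[OF that(3)]
      by (metis map_le_imp_restrict map_le_refl psubsetI)
  qed
  have "inj_on (zeta_EF n) (carrier ?P)"
  proof (rule inj_onI)
    fix a b assume ab: "a \<in> carrier ?P" "b \<in> carrier ?P" "zeta_EF n a = zeta_EF n b"
    have "(\<Sum>f\<in>?X. of_bool (m \<subseteq>\<^sub>m f) * (a f - b f)) = 0" for m
      using fun_cong[OF ab(3), of m] by (simp add: zeta_EF_def algebra_simps sum_subtractf)
    then have "\<forall>f\<in>?X. a f - b f = 0"
      using rank by (intro zeta_transform_inj[where leq = "(\<subseteq>\<^sub>m)" and r = "\<lambda>f. card (dom f)"])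
        (auto simp: finite_arrows_EF)
    then show "a = b"
      using ab(1,2) by (force simp: PF.carrier_category_algebra fun_eq_iff)
  qed
  moreover have "\<exists>a\<in>carrier ?P. zeta_EF n a = b" if b: "b \<in> carrier ?E" for b
  proof -
    obtain a where a: "\<forall>f. f \<notin> ?X \<longrightarrow> a f = 0"
      "\<forall>m\<in>?X. (\<Sum>f\<in>?X. of_bool (m \<subseteq>\<^sub>m f) * a f) = b m"
      using zeta_transform_surj[OF finite_arrows_EF, of n "(\<subseteq>\<^sub>m)" "\<lambda>f. card (dom f)" b] rank
      by auto
    have "zeta_EF n a m = b m" for m
      using a(2) b closed[of a] unfolding EF.carrier_category_algebra
      by (cases "m \<in> ?X") (auto simp: zeta_EF_def)
    then show ?thesis
      using a(1) by (intro bexI[of _ a]) (auto simp: PF.carrier_category_algebra)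
  qed
  ultimately have "bij_betw (zeta_EF n) (carrier ?P) (carrier ?E)"
    using closed by (fastforce simp: bij_betw_def)
  then show ?thesis
    by (intro ring_iso_memI)
      (simp_all add: closed one zeta_EF_mult EF.category_algebra_simps(3)
        PF.category_algebra_simps(3) add)
qed

theorem loewy_length_PF:
  "loewy_length (monoid_algebra K (PF n)) = loewy_length (category_algebra K (EF n))"
  unfolding monoid_algebra_eq_category_algebra
  using PF.ring_category_algebra EF.ring_category_algebra zeta_EF_ring_iso
  by (rule loewy_length_iso)

theorem proposition4p46:
  fixes n :: nat
  assumes "n \<ge> 1"
  shows "loewy_length (category_algebra TYPE('k::field) (EF n)) = (n choose 2) + 1 \<and>
         loewy_length (monoid_algebra TYPE('k) (PF n)) = (n choose 2) + 1"
  using loewy_length_EF[OF assms] by (simp add: loewy_length_PF)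

end
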